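(* Let $m,n,t$ be positive integers with $2^t \leq m \leq 2^n$. Then $$D(m,n,2t) \ \leq\ \left(\frac{8e}{t}\right)^{2t}\cdot (n\cdot \ell)^t\cdot m,$$ where $$\ell=\ell(m)=\min\left\{\left\lceil \frac{2\log m}{\log n-\log\log m}\right\rceil,\ \lfloor \log m\rfloor\right\}.$$
   Context: All logarithms $\log$ are base two, and $e$ is the base of the natural logarithm. For positive integers $n,r$, $Q_n^r$ is the graph with vertex set $\{0,1\}^n$ in which two distinct vectors are adjacent if and only if they differ in at most $r$ coordinates (Hamming distance at most $r$). For $\mathcal{A}\subseteq\{0,1\}^n$, $e_{Q_n^r}(\mathcal{A})$ is the number of edges of $Q_n^r$ with both endpoints in $\mathcal{A}$. For $m\le 2^n$, $D(m,n,r):=\max\{e_{Q_n^r}(\mathcal{A}) : \mathcal{A}\subseteq\{0,1\}^n,\ |\mathcal{A}|=m\}$. Convention: when $\log m=n$ (so that the denominator $\log n-\log\log m$ is zero), the first term in the minimum is read as $+\infty$, so $\ell=\lfloor\log m\rfloor$. *)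

theory Defs
  imports Complex_Main "HOL-Library.FuncSet"
begin

definition cube :: "nat \<Rightarrow> (nat \<Rightarrow> nat) set" where
  "cube n = {..<n} \<rightarrow>\<^sub>E {0, 1}"

definition hamming_dist :: "nat \<Rightarrow> (nat \<Rightarrow> nat) \<Rightarrow> (nat \<Rightarrow> nat) \<Rightarrow> nat" where
  "hamming_dist n x y = card {i. i < n \<and> x i \<noteq> y i}"

text \<open>The edges of the graph \<open>Q\<^sub>n\<^sup>r\<close>, as unordered pairs of distinct vertices.\<close>

definition Q_edges :: "nat \<Rightarrow> nat \<Rightarrow> (nat \<Rightarrow> nat) set set" where
  "Q_edges n r = {{x, y} | x y. x \<in> cube n \<and> y \<in> cube n \<and> x \<noteq> y \<and> hamming_dist n x y \<le> r}"

definition e_Q :: "nat \<Rightarrow> nat \<Rightarrow> (nat \<Rightarrow> nat) set \<Rightarrow> nat" where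
  "e_Q n r A = card {e \<in> Q_edges n r. e \<subseteq> A}"

text \<open>The maximum is taken over a finite set, which is nonempty exactly when \<open>m \<le> 2 ^ n\<close>;
  for other \<open>m\<close> the value of \<open>D\<close> is unspecified.\<close>

definition D :: "nat \<Rightarrow> nat \<Rightarrow> nat \<Rightarrow> nat" where
  "D m n r = Max {e_Q n r A | A. A \<subseteq> cube n \<and> card A = m}"

text \<open>If \<open>log 2 m = n\<close>, then the denominator \<open>log 2 n - log 2 (log 2 m)\<close> vanishes and
  the quotient is read as \<open>+\<infinity>\<close>, so that only the second term of the minimum remains.
  (In HOL the quotient would be \<open>0\<close>, hence the case distinction.)\<close>

definition ell :: "nat \<Rightarrow> nat \<Rightarrow> int" where
  "ell m n =
    (if log 2 (real m) = real n then \<lfloor>log 2 (real m)\<rfloor>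
     else min \<lceil>2 * log 2 (real m) / (log 2 (real n) - log 2 (log 2 (real m)))\<rceil>
              \<lfloor>log 2 (real m)\<rfloor>)"

end

theory Submission
  imports Defs
begin

text \<open>
  A vertex of the cube is identified with its support, so that a vertex set of size \<open>m\<close> becomes a
  family of \<open>m\<close> finite sets. Compressing in one coordinate after another turns the family into a
  down-set of the same size and does not decrease the number of pairs at Hamming distance at most
  \<open>2 t\<close> (\<open>exists_down_closed_family\<close>). Two features of a down-set are then exploited.

  First, two members \<open>x\<close>, \<open>y\<close> at distance \<open>d\<close> are joined, inside the down-set, by at least
  \<open>card (x - y)! * card (y - x)!\<close> walks of length \<open>d\<close> whose steps change one element: delete the
  elements of \<open>x - y\<close> in any order, then add those of \<open>y - x\<close> in any order. This is at least
  \<open>d! / 2 ^ d\<close>, so few walks mean few close pairs. If \<open>c\<close> bounds the norm of the adjacency operator of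
  the subgraph of the ordinary cube induced on the down-set, there are at most \<open>c ^ d * m\<close> walks of
  length \<open>d\<close>. Summing \<open>(2 * c) ^ d / d!\<close> over \<open>d \<le> 2 * t\<close> gives
  \<open>(c * e / t) ^ (2 * t) * m\<close> close pairs as soon as \<open>t \<le> c\<close>. So the theorem reduces to
  \<open>c = O(sqrt (n * \<ell>))\<close>.

  Secondly, the members of a down-set of size \<open>m\<close> have at most \<open>log m\<close> elements. Counting
  neighbours alone gives the norm \<open>2 * sqrt (n * log m)\<close>, which is enough if \<open>\<ell> = \<lfloor>log m\<rfloor>\<close>. In
  the other case the edges of the induced subgraph are divided into two classes: in the first, every
  set has at most about \<open>n * \<ell> / log m\<close> edges upwards; in the second, at most \<open>\<ell>\<close> edges downwards.
  In both classes the product of the upward and the downward degree bound is at most \<open>n * \<ell>\<close>, and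
  the arithmetic-geometric mean inequality bounds the norm of each class (\<open>schur_test\<close>). The
  division is found by greedily peeling off vertices of low degree (\<open>bipartite_peeling\<close>). If the
  peeling got stuck, there would be a subgraph in which all upward degrees exceed \<open>n * \<ell> / log m\<close> and
  all downward degrees exceed \<open>\<ell>\<close>. Such a subgraph generates at least
  \<open>(n * \<ell> / log m) ^ \<ell> / \<ell>!\<close> sets with \<open>\<ell>\<close> elements (\<open>dense_covers_large_family\<close>), which is at
  least \<open>(n / log m) ^ \<ell>\<close>, and hence at least \<open>m ^ 2\<close> by the choice of \<open>\<ell>\<close>: too many.
\<close>

section \<open>Splitting the cover relation of a down-set\<close>

text \<open>
  Repeatedly remove a vertex of low degree together with its remaining edges. The edges go to \<open>F1\<close>
  if the vertex is on the left and to \<open>F2\<close> if it is on the right. Each vertex is removed at most once,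
  so it contributes to the class of its own side only the few edges that it had left.
\<close>

lemma bipartite_peeling:
  fixes H :: "('a \<times> 'b) set"
  assumes "finite H"
    and "\<And>K. K \<subseteq> H \<Longrightarrow> K \<noteq> {} \<Longrightarrow>
      (\<exists>z\<in>Domain K. card (K `` {z}) \<le> p) \<or> (\<exists>x\<in>Range K. card (K\<inverse> `` {x}) \<le> q)"
  shows "\<exists>F1 F2. H = F1 \<union> F2 \<and> (\<forall>z. card (F1 `` {z}) \<le> p) \<and> (\<forall>x. card (F2\<inverse> `` {x}) \<le> q)"
  using assms
proof (induction H rule: finite_psubset_induct)
  case (psubset H)
  show ?case
  proof (cases "H = {}")
    case True
    then show ?thesis by auto
  next
    case False
    then consider (left) z where "z \<in> Domain H" "card (H `` {z}) \<le> p"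
      | (right) x where "x \<in> Range H" "card (H\<inverse> `` {x}) \<le> q"
      using psubset.prems[of H] by auto
    then show ?thesis
    proof cases
      case left
      define H' where "H' = {e \<in> H. fst e \<noteq> z}"
      obtain b where "(z, b) \<in> H" using left(1) by blast
      then have "(z, b) \<in> H - H'" unfolding H'_def by simp
      then have "H' \<subset> H" unfolding H'_def by blast
      moreover from this have "\<And>K. K \<subseteq> H' \<Longrightarrow> K \<noteq> {} \<Longrightarrow>
          (\<exists>z\<in>Domain K. card (K `` {z}) \<le> p) \<or> (\<exists>x\<in>Range K. card (K\<inverse> `` {x}) \<le> q)"
        by (intro psubset.prems) auto
      ultimately obtain F1 F2 where F: "H' = F1 \<union> F2" "\<forall>z. card (F1 `` {z}) \<le> p"
          "\<forall>x. card (F2\<inverse> `` {x}) \<le> q"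
        using psubset.IH[of H'] by blast
      have "F1 \<subseteq> H'" using F(1) by blast
      then have "F1 `` {z} = {}" unfolding H'_def by fastforce
      then have "(F1 \<union> {e \<in> H. fst e = z}) `` {y} = (if y = z then H `` {z} else F1 `` {y})" for y
        by auto
      then have "\<forall>y. card ((F1 \<union> {e \<in> H. fst e = z}) `` {y}) \<le> p"
        using F(2) left(2) by simp
      moreover have "H = H' \<union> {e \<in> H. fst e = z}" unfolding H'_def by auto
      then have "H = (F1 \<union> {e \<in> H. fst e = z}) \<union> F2" using F(1) by blast
      ultimately show ?thesis using F(3) by blast
    next
      case right
      define H' where "H' = {e \<in> H. snd e \<noteq> x}"
      obtain b where "(b, x) \<in> H" using right(1) by blast
      then have "(b, x) \<in> H - H'" unfolding H'_def by simp
      then have "H' \<subset> H" unfolding H'_def by blast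
      moreover from this have "\<And>K. K \<subseteq> H' \<Longrightarrow> K \<noteq> {} \<Longrightarrow>
          (\<exists>z\<in>Domain K. card (K `` {z}) \<le> p) \<or> (\<exists>x\<in>Range K. card (K\<inverse> `` {x}) \<le> q)"
        by (intro psubset.prems) auto
      ultimately obtain F1 F2 where F: "H' = F1 \<union> F2" "\<forall>z. card (F1 `` {z}) \<le> p"
          "\<forall>x. card (F2\<inverse> `` {x}) \<le> q"
        using psubset.IH[of H'] by blast
      have "F2 \<subseteq> H'" using F(1) by blast
      then have "F2\<inverse> `` {x} = {}" unfolding H'_def by fastforce
      then have "(F2 \<union> {e \<in> H. snd e = x})\<inverse> `` {y} = (if y = x then H\<inverse> `` {x} else F2\<inverse> `` {y})" for y
        by auto
      then have "\<forall>y. card ((F2 \<union> {e \<in> H. snd e = x})\<inverse> `` {y}) \<le> q"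
        using F(3) right(2) by simp
      moreover have "H = H' \<union> {e \<in> H. snd e = x}" unfolding H'_def by auto
      then have "H = F1 \<union> (F2 \<union> {e \<in> H. snd e = x})" using F(1) by blast
      ultimately show ?thesis using F(2) by blast
    qed
  qed
qed

definition down_closed :: "'a set set \<Rightarrow> bool" where
  "down_closed A \<longleftrightarrow> (\<forall>x\<in>A. \<forall>y\<subseteq>x. y \<in> A)"

definition covers :: "'a set set \<Rightarrow> ('a set \<times> 'a set) set" where
  "covers A = {(z, x). z \<in> A \<and> x \<in> A \<and> (\<exists>i. i \<notin> z \<and> x = insert i z)}"

lemma card_lower_covers_le:
  assumes "finite x"
  shows "card ((covers A)\<inverse> `` {x}) \<le> card x"
proof -
  have "(covers A)\<inverse> `` {x} \<subseteq> (\<lambda>i. x - {i}) ` x" unfolding covers_def by auto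
  then show ?thesis using assms by (meson card_image_le card_mono finite_imageI le_trans)
qed

text \<open>
  Let \<open>J s\<close> consist of the sets of size \<open>s\<close> below some upper endpoint \<open>x\<close> of \<open>K\<close>. While \<open>s < q\<close>,
  a set \<open>w\<close> in \<open>J s\<close> cannot contain all the elements that may be deleted from \<open>x\<close>, so \<open>w\<close> stays
  below a lower endpoint \<open>z\<close>; the at least \<open>p\<close> elements that may be added to \<open>z\<close> extend \<open>w\<close> to
  members of \<open>J (Suc s)\<close>. A member of \<open>J (Suc s)\<close> arises from at most \<open>Suc s\<close> sets. Hence
  \<open>J s\<close> grows by a factor of at least \<open>p / Suc s\<close> in each step, and all of these sets lie in the
  down-set.
\<close>

lemma dense_covers_large_family:
  fixes A :: "'a set set"
  assumes fin: "finite A" "\<And>x. x \<in> A \<Longrightarrow> finite x" and down: "down_closed A"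
    and K: "K \<subseteq> covers A" "K \<noteq> {}"
    and up: "\<And>z. z \<in> Domain K \<Longrightarrow> p \<le> card (K `` {z})"
    and dn: "\<And>x. x \<in> Range K \<Longrightarrow> q \<le> card (K\<inverse> `` {x})"
  shows "p ^ q \<le> card A * fact q"
proof -
  define J where "J s = {w. card w = s \<and> (\<exists>x\<in>Range K. w \<subseteq> x)}" for s
  have RA: "Range K \<subseteq> A" using K(1) unfolding covers_def by auto
  have JA: "J s \<subseteq> A" for s
    using RA down unfolding J_def down_closed_def by blast
  then have finJ: "finite (J s)" for s using fin(1) finite_subset by blast
  have step: "p * card (J s) \<le> Suc s * card (J (Suc s))" if "s < q" for s
  proof -
    let ?P = "\<lambda>w w'. w \<subseteq> w'"
    have ext: "p \<le> card {w' \<in> J (Suc s). w \<subseteq> w'}" if w: "w \<in> J s" for w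
    proof -
      obtain x where x: "x \<in> Range K" "w \<subseteq> x" and cw: "card w = s"
        using w unfolding J_def by blast
      have "finite x" using x(1) RA fin(2) by blast
      then have fw: "finite w" using x(2) finite_subset by blast
      \<comment> \<open>at least \<open>q > s\<close> elements can be deleted from \<open>x\<close>, so one of them is outside \<open>w\<close>\<close>
      have "\<exists>z. (z, x) \<in> K \<and> w \<subseteq> z"
      proof (rule ccontr)
        assume *: "\<nexists>z. (z, x) \<in> K \<and> w \<subseteq> z"
        have "K\<inverse> `` {x} \<subseteq> (\<lambda>i. x - {i}) ` w"
        proof
          fix z assume "z \<in> K\<inverse> `` {x}"
          then have zx: "(z, x) \<in> K" by simp
          then obtain i where i: "i \<notin> z" "x = insert i z" using K(1) unfolding covers_def by auto
          then have "z = x - {i}" by auto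
          moreover have "i \<in> w" using * zx x(2) i by blast
          ultimately show "z \<in> (\<lambda>i. x - {i}) ` w" by blast
        qed
        then have "card (K\<inverse> `` {x}) \<le> card w"
          using fw by (meson card_image_le card_mono finite_imageI le_trans)
        then show False using dn[OF x(1)] cw \<open>s < q\<close> by simp
      qed
      then obtain z where z: "(z, x) \<in> K" "w \<subseteq> z" by blast
      have "z \<in> Domain K" using z(1) by blast
      have inj: "inj_on (\<lambda>x'. w \<union> (x' - z)) (K `` {z})"
      proof (rule inj_onI)
        fix a b assume ab: "a \<in> K `` {z}" "b \<in> K `` {z}" "w \<union> (a - z) = w \<union> (b - z)"
        then have "z \<subseteq> a" "z \<subseteq> b" using K(1) unfolding covers_def by auto
        moreover have "a - z = b - z" using ab(3) z(2) by blast
        ultimately show "a = b" by blast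
      qed
      have "(\<lambda>x'. w \<union> (x' - z)) ` (K `` {z}) \<subseteq> {w' \<in> J (Suc s). w \<subseteq> w'}"
      proof safe
        fix x' assume zx': "(z, x') \<in> K"
        then obtain i where i: "i \<notin> z" "x' = insert i z" using K(1) unfolding covers_def by auto
        have eq: "w \<union> (x' - z) = insert i w" using i by auto
        have "i \<notin> w" using i z(2) by blast
        then have "card (insert i w) = Suc s" using cw fw by simp
        moreover have "insert i w \<subseteq> x'" using i z(2) by blast
        ultimately show "w \<union> (x' - z) \<in> J (Suc s)"
          unfolding J_def eq using zx' by blast
      qed
      then have "card (K `` {z}) \<le> card {w' \<in> J (Suc s). w \<subseteq> w'}"
        by (intro card_inj_on_le[OF inj]) (auto simp: finJ)
      then show ?thesis using up[OF \<open>z \<in> Domain K\<close>] by simp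
    qed
    have sub: "card {w \<in> J s. w \<subseteq> w'} \<le> Suc s" if w': "w' \<in> J (Suc s)" for w'
    proof -
      have cw': "card w' = Suc s" using w' unfolding J_def by blast
      then have fw': "finite w'" using card.infinite by fastforce
      have "{w \<in> J s. w \<subseteq> w'} \<subseteq> {w. w \<subseteq> w' \<and> card w = s}" unfolding J_def by auto
      then have "card {w \<in> J s. w \<subseteq> w'} \<le> card {w. w \<subseteq> w' \<and> card w = s}"
        by (rule card_mono[rotated]) (simp add: fw')
      also have "\<dots> = Suc s choose s" using n_subsets[OF fw'] cw' by simp
      finally show ?thesis by simp
    qed
    \<comment> \<open>count the inclusions between \<open>J s\<close> and \<open>J (Suc s)\<close> from both sides\<close>
    have "p * card (J s) = (\<Sum>w\<in>J s. p)" by simp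
    also have "\<dots> \<le> (\<Sum>w\<in>J s. card {w' \<in> J (Suc s). w \<subseteq> w'})" by (intro sum_mono ext)
    also have "\<dots> = (\<Sum>w\<in>J s. \<Sum>w' | w' \<in> J (Suc s) \<and> w \<subseteq> w'. 1)" by simp
    also have "\<dots> = (\<Sum>w'\<in>J (Suc s). \<Sum>w | w \<in> J s \<and> w \<subseteq> w'. 1)"
      by (rule sum.swap_restrict) (auto simp: finJ)
    also have "\<dots> \<le> (\<Sum>w'\<in>J (Suc s). Suc s)" using sub by (intro sum_mono) auto
    finally show ?thesis by (simp add: mult.commute)
  qed
  have "s \<le> q \<Longrightarrow> p ^ s \<le> card (J s) * fact s" for s
  proof (induction s)
    case 0
    obtain a b where "(a, b) \<in> K" using K(2) by auto
    then have "{} \<in> J 0" unfolding J_def by auto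
    then have "card (J 0) \<noteq> 0" using finJ by auto
    then show ?case by (simp add: Suc_le_eq)
  next
    case (Suc s)
    have "p ^ Suc s \<le> p * (card (J s) * fact s)" using Suc by simp
    also have "\<dots> = (p * card (J s)) * fact s" by (simp add: mult.assoc)
    also have "\<dots> \<le> (Suc s * card (J (Suc s))) * fact s"
      using step Suc.prems by (intro mult_right_mono) auto
    finally show ?case by (simp add: algebra_simps)
  qed
  from this[of q] have "p ^ q \<le> card (J q) * fact q" by simp
  also have "\<dots> \<le> card A * fact q" using card_mono[OF fin(1) JA] by simp
  finally show ?thesis .
qed

lemma covers_split:
  fixes A :: "'a set set"
  assumes fin: "finite A" "\<And>x. x \<in> A \<Longrightarrow> finite x" and down: "down_closed A"
    and small: "card A * fact q < (p + 1) ^ q"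
  shows "\<exists>F1 F2. covers A = F1 \<union> F2 \<and> (\<forall>z. card (F1 `` {z}) \<le> p) \<and>
    (\<forall>x. card (F2\<inverse> `` {x}) \<le> q)"
proof (rule bipartite_peeling)
  have "covers A \<subseteq> A \<times> A" unfolding covers_def by auto
  then show "finite (covers A)" using fin(1) finite_subset by blast
  fix K assume K: "K \<subseteq> covers A" "K \<noteq> {}"
  show "(\<exists>z\<in>Domain K. card (K `` {z}) \<le> p) \<or> (\<exists>x\<in>Range K. card (K\<inverse> `` {x}) \<le> q)"
  proof (rule ccontr)
    assume "\<not> ?thesis"
    then have "(p + 1) ^ q \<le> card A * fact q"
      by (intro dense_covers_large_family[OF fin down K]) force+
    then show False using small by simp
  qed
qed

section \<open>Degrees, quadratic forms and walks\<close>

text \<open>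
  Each product is at most \<open>(c * (g z)\<^sup>2 + (f x)\<^sup>2 / c) / 2\<close> for every \<open>c > 0\<close>; summation over the edges
  replaces the squares by at most \<open>a\<close> and \<open>b\<close> copies of them, and \<open>c = b / s\<close> balances the two terms.
\<close>

lemma schur_test:
  fixes F :: "('a \<times> 'b) set" and f :: "'b \<Rightarrow> real" and g :: "'a \<Rightarrow> real"
  assumes fin: "finite A" "finite B" and F: "F \<subseteq> A \<times> B"
    and out: "\<And>z. z \<in> A \<Longrightarrow> real (card (F `` {z})) \<le> a"
    and into: "\<And>x. x \<in> B \<Longrightarrow> real (card (F\<inverse> `` {x})) \<le> b"
    and s: "0 < b" "0 < s" "a * b \<le> s\<^sup>2"
  shows "(\<Sum>(z, x)\<in>F. g z * f x) \<le> s / 2 * ((\<Sum>z\<in>A. (g z)\<^sup>2) + (\<Sum>x\<in>B. (f x)\<^sup>2))"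
proof -
  define c where "c = b / s"
  have c: "0 < c" "c * a \<le> s" "b / c = s" using s
    by (auto simp: c_def field_simps power2_eq_square)
  have finF: "finite F" using fin F finite_subset by blast
  have amgm: "g z * f x \<le> c / 2 * (g z)\<^sup>2 + 1 / (2 * c) * (f x)\<^sup>2" for z x
  proof -
    have "0 \<le> (c * g z - f x)\<^sup>2 / (2 * c)" using c by simp
    also have "\<dots> = c / 2 * (g z)\<^sup>2 + 1 / (2 * c) * (f x)\<^sup>2 - g z * f x"
      using c(1) by (simp add: field_simps power2_eq_square)
    finally show ?thesis by simp
  qed
  have rows: "(\<Sum>(z, x)\<in>F. (g z)\<^sup>2) \<le> a * (\<Sum>z\<in>A. (g z)\<^sup>2)"
  proof -
    have F_eq: "(SIGMA z:A. F `` {z}) = F" using F by auto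
    have "(\<Sum>(z, x)\<in>F. (g z)\<^sup>2) = (\<Sum>z\<in>A. \<Sum>x\<in>F `` {z}. (g z)\<^sup>2)"
      by (subst sum.Sigma) (simp_all add: F_eq fin finF finite_Image)
    also have "\<dots> = (\<Sum>z\<in>A. real (card (F `` {z})) * (g z)\<^sup>2)" by simp
    also have "\<dots> \<le> (\<Sum>z\<in>A. a * (g z)\<^sup>2)"
      using out by (intro sum_mono mult_right_mono) auto
    finally show ?thesis by (simp add: sum_distrib_left)
  qed
  have cols: "(\<Sum>(z, x)\<in>F. (f x)\<^sup>2) \<le> b * (\<Sum>x\<in>B. (f x)\<^sup>2)"
  proof -
    have F_eq: "(SIGMA x:B. F\<inverse> `` {x}) = F\<inverse>" using F by auto
    have "(\<Sum>(x, z)\<in>F\<inverse>. (f x)\<^sup>2) = (\<Sum>x\<in>B. \<Sum>z\<in>F\<inverse> `` {x}. (f x)\<^sup>2)"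
      by (subst sum.Sigma) (simp_all add: F_eq fin finF finite_Image)
    also have "\<dots> = (\<Sum>x\<in>B. real (card (F\<inverse> `` {x})) * (f x)\<^sup>2)" by simp
    also have "\<dots> \<le> (\<Sum>x\<in>B. b * (f x)\<^sup>2)"
      using into by (intro sum_mono mult_right_mono) auto
    also have "(\<Sum>(x, z)\<in>F\<inverse>. (f x)\<^sup>2) = (\<Sum>(z, x)\<in>F. (f x)\<^sup>2)"
      by (rule sum.reindex_bij_witness[of _ prod.swap prod.swap]) auto
    finally show ?thesis by (simp add: sum_distrib_left)
  qed
  have "(\<Sum>(z, x)\<in>F. g z * f x) \<le> (\<Sum>(z, x)\<in>F. c / 2 * (g z)\<^sup>2 + 1 / (2 * c) * (f x)\<^sup>2)"
    by (intro sum_mono) (use amgm in auto)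
  also have "\<dots> = c / 2 * (\<Sum>(z, x)\<in>F. (g z)\<^sup>2) + 1 / (2 * c) * (\<Sum>(z, x)\<in>F. (f x)\<^sup>2)"
    by (simp add: case_prod_unfold sum.distrib sum_distrib_left)
  also have "\<dots> \<le> c / 2 * (a * (\<Sum>z\<in>A. (g z)\<^sup>2)) + 1 / (2 * c) * (b * (\<Sum>x\<in>B. (f x)\<^sup>2))"
    using rows cols c(1) by (intro add_mono mult_left_mono) auto
  also have "\<dots> = (c * a) / 2 * (\<Sum>z\<in>A. (g z)\<^sup>2) + (b / c) / 2 * (\<Sum>x\<in>B. (f x)\<^sup>2)" by simp
  also have "\<dots> \<le> s / 2 * (\<Sum>z\<in>A. (g z)\<^sup>2) + s / 2 * (\<Sum>x\<in>B. (f x)\<^sup>2)"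
    using c by (intro add_mono mult_right_mono) (auto simp: sum_nonneg)
  finally show ?thesis by (simp add: algebra_simps)
qed

fun walks :: "('a \<times> 'a) set \<Rightarrow> nat \<Rightarrow> 'a \<Rightarrow> 'a \<Rightarrow> nat" where
  "walks G 0 x y = of_bool (x = y)"
| "walks G (Suc d) x y = (\<Sum>x'\<in>G `` {x}. walks G d x' y)"

text \<open>
  The inequality \<open>form\<close> is a bound \<open>c\<close> on the norm of the adjacency operator \<open>M\<close>, written without
  square roots: taking \<open>g = M f / c\<close> recovers the usual inequality for the norm of \<open>M f\<close>. For
  nonnegative functions, the sum over a union of edge classes is at most the sum of the sums over the
  classes, even if these overlap.
\<close>

lemma adjacency_norm_bound:
  fixes G :: "('a \<times> 'a) set" and f :: "'a \<Rightarrow> real"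
  assumes A: "finite A" "G \<subseteq> A \<times> A" and c: "0 < c"
    and form: "\<And>g f. (\<And>x. (0::real) \<le> g x) \<Longrightarrow> (\<And>x. (0::real) \<le> f x) \<Longrightarrow>
      (\<Sum>(x, y)\<in>G. g x * f y) \<le> c / 2 * ((\<Sum>x\<in>A. (g x)\<^sup>2) + (\<Sum>x\<in>A. (f x)\<^sup>2))"
    and f: "\<And>x. 0 \<le> f x"
  shows "(\<Sum>x\<in>A. (\<Sum>y\<in>G `` {x}. f y)\<^sup>2) \<le> c\<^sup>2 * (\<Sum>x\<in>A. (f x)\<^sup>2)"
proof -
  define h where "h x = (\<Sum>y\<in>G `` {x}. f y)" for x
  let ?N = "\<Sum>x\<in>A. (h x)\<^sup>2"
  have h: "0 \<le> h x" for x unfolding h_def using f by (intro sum_nonneg)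
  have G_eq: "(SIGMA x:A. G `` {x}) = G" using A(2) by auto
  have finG: "finite G" using A finite_subset by blast
  have "h x / c * h x = (\<Sum>y\<in>G `` {x}. (h x / c) * f y)" for x
    by (metis h_def sum_distrib_left)
  then have "?N / c = (\<Sum>x\<in>A. \<Sum>y\<in>G `` {x}. (h x / c) * f y)"
    by (simp add: sum_divide_distrib power2_eq_square)
  also have "\<dots> = (\<Sum>(x, y)\<in>G. (h x / c) * f y)"
    by (subst sum.Sigma) (simp_all add: A(1) finG finite_Image G_eq)
  also have "\<dots> \<le> c / 2 * ((\<Sum>x\<in>A. (h x / c)\<^sup>2) + (\<Sum>x\<in>A. (f x)\<^sup>2))"
    using h f c by (intro form) auto
  also have "(\<Sum>x\<in>A. (h x / c)\<^sup>2) = ?N / c\<^sup>2"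
    by (simp add: power_divide sum_divide_distrib)
  finally have "?N \<le> c\<^sup>2 * (\<Sum>x\<in>A. (f x)\<^sup>2)"
    using c by (simp add: field_simps power2_eq_square)
  then show ?thesis unfolding h_def .
qed

text \<open>
  The vector counting the walks by their starting point is the image of the all-ones vector under the
  \<open>d\<close>-th power of the adjacency operator. Its norm is controlled by induction, and the
  sum of its entries by the arithmetic-geometric mean inequality.
\<close>

lemma walks_total_bound:
  fixes G :: "('a \<times> 'a) set"
  assumes A: "finite A" "G \<subseteq> A \<times> A" and c: "0 < c"
    and form: "\<And>g f. (\<And>x. (0::real) \<le> g x) \<Longrightarrow> (\<And>x. (0::real) \<le> f x) \<Longrightarrow>
      (\<Sum>(x, y)\<in>G. g x * f y) \<le> c / 2 * ((\<Sum>x\<in>A. (g x)\<^sup>2) + (\<Sum>x\<in>A. (f x)\<^sup>2))"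
  shows "real (\<Sum>x\<in>A. \<Sum>y\<in>A. walks G d x y) \<le> c ^ d * real (card A)"
proof -
  define W where "W d x = real (\<Sum>y\<in>A. walks G d x y)" for d x
  have W_Suc: "W (Suc d) x = (\<Sum>x'\<in>G `` {x}. W d x')" for d x
    unfolding W_def by (simp add: sum.swap[of _ A])
  have sq: "(\<Sum>x\<in>A. (W d x)\<^sup>2) \<le> (c ^ d)\<^sup>2 * real (card A)" for d
  proof (induction d)
    case 0
    have "W 0 x = 1" if "x \<in> A" for x
      using that A(1) by (simp add: W_def of_bool_def if_distrib sum.delta cong: if_cong)
    then show ?case by simp
  next
    case (Suc d)
    have "(\<Sum>x\<in>A. (W (Suc d) x)\<^sup>2) \<le> c\<^sup>2 * (\<Sum>x\<in>A. (W d x)\<^sup>2)"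
      unfolding W_Suc by (intro adjacency_norm_bound[OF A c form]) (auto simp: W_def intro!: sum_nonneg)
    also have "\<dots> \<le> c\<^sup>2 * ((c ^ d)\<^sup>2 * real (card A))"
      using Suc by (intro mult_left_mono) auto
    finally show ?case by (simp add: power_mult_distrib mult_ac)
  qed
  have cd: "0 < c ^ d" using c by simp
  have amgm: "w \<le> (a + w\<^sup>2 / a) / 2" if "0 < a" for a w :: real
  proof -
    have "0 \<le> (a - w)\<^sup>2 / a" using that by simp
    also have "\<dots> = a + w\<^sup>2 / a - 2 * w"
      using that by (simp add: field_simps power2_eq_square)
    finally show ?thesis by simp
  qed
  have "(\<Sum>x\<in>A. W d x) \<le> (\<Sum>x\<in>A. (c ^ d + (W d x)\<^sup>2 / c ^ d) / 2)"
    by (intro sum_mono amgm cd)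
  also have "\<dots> = (c ^ d * real (card A) + (\<Sum>x\<in>A. (W d x)\<^sup>2) / c ^ d) / 2"
    by (simp add: sum_divide_distrib[symmetric] sum.distrib mult.commute)
  also have "\<dots> \<le> (c ^ d * real (card A) + ((c ^ d)\<^sup>2 * real (card A)) / c ^ d) / 2"
    using sq[of d] cd by (intro divide_right_mono add_mono) auto
  also have "\<dots> = c ^ d * real (card A)" using cd by (simp add: power2_eq_square)
  finally show ?thesis by (simp add: W_def)
qed

definition cover_graph :: "'a set set \<Rightarrow> ('a set \<times> 'a set) set" where
  "cover_graph A = covers A \<union> (covers A)\<inverse>"

lemma cover_graph_subset: "cover_graph A \<subseteq> A \<times> A"
  unfolding cover_graph_def covers_def by auto

lemma walks_between_close_sets:
  assumes fin: "finite A" and down: "down_closed A"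
    and xy: "x \<in> A" "y \<in> A" "finite x" "finite y" "card (x - y) = a" "card (y - x) = b"
  shows "fact a * fact b \<le> walks (cover_graph A) (a + b) x y"
  using xy
proof (induction "a + b" arbitrary: x a b)
  case 0
  then have "x = y" by auto
  then show ?case using 0 by simp
next
  case (Suc d)
  have finN: "finite (cover_graph A `` {x})"
    using finite_subset[OF cover_graph_subset] fin by (intro finite_Image) blast
  \<comment> \<open>deleting before adding keeps the walk below \<open>x\<close> at first and below \<open>y\<close> afterwards, hence
    inside the down-set\<close>
  show ?case
  proof (cases a)
    case (Suc a')
    let ?N = "(\<lambda>i. x - {i}) ` (x - y)"
    have sub: "?N \<subseteq> cover_graph A `` {x}"
    proof safe
      fix i assume i: "i \<in> x" "i \<notin> y"
      then have "(x - {i}, x) \<in> covers A"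
        using down Suc.prems(1) unfolding covers_def down_closed_def by blast
      then show "(x, x - {i}) \<in> cover_graph A" unfolding cover_graph_def by blast
    qed
    have w: "fact a' * fact b \<le> walks (cover_graph A) d z y" if z: "z \<in> ?N" for z
    proof -
      obtain i where i: "i \<in> x - y" "z = x - {i}" using z by blast
      have "z \<in> A" using sub z cover_graph_subset[of A] by blast
      moreover have "z - y = (x - y) - {i}" "y - z = y - x" using i by auto
      then have "card (z - y) = a'" "card (y - z) = b"
        using i Suc.prems \<open>a = Suc a'\<close> by auto
      moreover have "finite z" using i Suc.prems by auto
      ultimately have "fact a' * fact b \<le> walks (cover_graph A) (a' + b) z y"
        using Suc.hyps(2) \<open>a = Suc a'\<close> Suc.prems by (intro Suc.hyps(1)) auto
      then show ?thesis using Suc.hyps(2) \<open>a = Suc a'\<close> by simp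
    qed
    have "card ?N = a"
      using Suc.prems(5) by (subst card_image) (auto simp: inj_on_def)
    then have "fact a * fact b = (\<Sum>z\<in>?N. fact a' * fact b)"
      using \<open>a = Suc a'\<close> by (simp add: algebra_simps)
    also have "\<dots> \<le> (\<Sum>z\<in>?N. walks (cover_graph A) d z y)" using w by (intro sum_mono)
    also have "\<dots> \<le> (\<Sum>z\<in>cover_graph A `` {x}. walks (cover_graph A) d z y)"
      using sub finN by (intro sum_mono2) auto
    finally show ?thesis using Suc.hyps(2)[symmetric] by simp
  next
    case 0
    then obtain b' where b': "b = Suc b'" using Suc.hyps(2) by (cases b) auto
    have "x \<subseteq> y" using 0 Suc.prems by auto
    let ?N = "(\<lambda>i. insert i x) ` (y - x)"
    have sub: "?N \<subseteq> cover_graph A `` {x}"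
    proof safe
      fix i assume i: "i \<in> y" "i \<notin> x"
      have "insert i x \<in> A" using i \<open>x \<subseteq> y\<close> Suc.prems(2) down
        unfolding down_closed_def by blast
      then have "(x, insert i x) \<in> covers A" using i Suc.prems(1) unfolding covers_def by blast
      then show "(x, insert i x) \<in> cover_graph A" unfolding cover_graph_def by blast
    qed
    have w: "fact b' \<le> walks (cover_graph A) d z y" if z: "z \<in> ?N" for z
    proof -
      obtain i where i: "i \<in> y - x" "z = insert i x" using z by blast
      have "z \<in> A" using sub z cover_graph_subset[of A] by blast
      moreover have "z - y = {}" "y - z = (y - x) - {i}" using i \<open>x \<subseteq> y\<close> by auto
      then have "card (z - y) = 0" "card (y - z) = b'"
        using i Suc.prems b' by auto
      moreover have "finite z" using i Suc.prems by auto
      ultimately have "fact 0 * fact b' \<le> walks (cover_graph A) (0 + b') z y"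
        using Suc.hyps(2) 0 b' Suc.prems by (intro Suc.hyps(1)) auto
      then show ?thesis using Suc.hyps(2) 0 b' by simp
    qed
    have "card ?N = b"
      using Suc.prems(6) by (subst card_image) (auto simp: inj_on_def)
    then have "fact b = (\<Sum>z\<in>?N. fact b')"
      using b' by (simp add: algebra_simps)
    also have "\<dots> \<le> (\<Sum>z\<in>?N. walks (cover_graph A) d z y)" using w by (intro sum_mono)
    also have "\<dots> \<le> (\<Sum>z\<in>cover_graph A `` {x}. walks (cover_graph A) d z y)"
      using sub finN by (intro sum_mono2) auto
    finally show ?thesis using Suc.hyps(2)[symmetric] 0 by simp
  qed
qed

text \<open>
  The factor 4 counts the two classes \<open>F1\<close>, \<open>F2\<close>, each traversed in both directions. In \<open>F1\<close> a set of
  size at most \<open>L\<close> has at most \<open>L\<close> edges downwards, and in \<open>F2\<close> a set has at most \<open>card V\<close> edges upwards,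
  so the two hypotheses on \<open>s\<^sup>2\<close> are those of \<open>schur_test\<close> for \<open>F1\<close> and \<open>F2\<close>.
\<close>

lemma cover_graph_quadratic_form:
  fixes A :: "'a set set" and f g :: "'a set \<Rightarrow> real"
  assumes V: "finite V" "A \<subseteq> Pow V" and size: "\<And>x. x \<in> A \<Longrightarrow> card x \<le> L"
    and split: "covers A = F1 \<union> F2" "\<And>z. card (F1 `` {z}) \<le> p" "\<And>x. card (F2\<inverse> `` {x}) \<le> q"
    and s: "0 < L" "0 < q" "0 < s" "real p * real L \<le> s\<^sup>2" "real (card V) * real q \<le> s\<^sup>2"
    and nonneg: "\<And>x. 0 \<le> g x" "\<And>x. 0 \<le> f x"
  shows "(\<Sum>(x, y)\<in>cover_graph A. g x * f y)
    \<le> (4 * s) / 2 * ((\<Sum>x\<in>A. (g x)\<^sup>2) + (\<Sum>x\<in>A. (f x)\<^sup>2))"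
proof -
  have A: "finite A" using V finite_subset by blast
  have EA: "covers A \<subseteq> A \<times> A" unfolding covers_def by auto
  then have finE: "finite (covers A)" using A finite_subset by blast
  have fin: "finite F1" "finite F2" using finE unfolding split(1) by auto
  have sub: "F1 \<subseteq> A \<times> A" "F2 \<subseteq> A \<times> A" using EA split(1) by auto
  have down: "card (F1\<inverse> `` {x}) \<le> L" if "x \<in> A" for x
  proof -
    have fx: "finite x" using that V finite_subset by blast
    have "F1\<inverse> `` {x} \<subseteq> (covers A)\<inverse> `` {x}" using split(1) by blast
    moreover have "finite ((covers A)\<inverse> `` {x})" using finE by (simp add: finite_Image)
    ultimately have "card (F1\<inverse> `` {x}) \<le> card x"
      using card_lower_covers_le[OF fx] by (meson card_mono le_trans)
    then show ?thesis using size[OF that] by simp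
  qed
  have up: "card (F2 `` {z}) \<le> card V" for z
  proof -
    have "F2 `` {z} \<subseteq> (\<lambda>i. insert i z) ` V"
    proof
      fix x assume "x \<in> F2 `` {z}"
      then have "(z, x) \<in> covers A" using split(1) by auto
      then show "x \<in> (\<lambda>i. insert i z) ` V" using V(2) unfolding covers_def by auto
    qed
    then show ?thesis using V(1) by (meson card_image_le card_mono finite_imageI le_trans)
  qed
  let ?S = "(\<Sum>x\<in>A. (g x)\<^sup>2) + (\<Sum>x\<in>A. (f x)\<^sup>2)"
  have b1: "(\<Sum>(z, x)\<in>F1. h z * k x) \<le> s / 2 * ((\<Sum>x\<in>A. (h x)\<^sup>2) + (\<Sum>x\<in>A. (k x)\<^sup>2))"
    for h k :: "'a set \<Rightarrow> real"
    by (rule schur_test[OF A A sub(1), of "real p" "real L"]) (use s split(2) down in auto)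
  have b2: "(\<Sum>(z, x)\<in>F2. h z * k x) \<le> s / 2 * ((\<Sum>x\<in>A. (h x)\<^sup>2) + (\<Sum>x\<in>A. (k x)\<^sup>2))"
    for h k :: "'a set \<Rightarrow> real"
    by (rule schur_test[OF A A sub(2), of "real (card V)" "real q"]) (use s split(3) up in auto)
  have conv: "(\<Sum>(x, y)\<in>F\<inverse>. g x * f y) = (\<Sum>(z, x)\<in>F. f z * g x)" for F
    by (rule sum.reindex_bij_witness[of _ prod.swap prod.swap]) auto
  have un: "(\<Sum>(x, y)\<in>F \<union> F'. g x * f y) \<le> (\<Sum>(x, y)\<in>F. g x * f y) + (\<Sum>(x, y)\<in>F'. g x * f y)"
    if "finite F" "finite F'" for F F' :: "('a set \<times> 'a set) set"
    using sum.union_inter[OF that, of "\<lambda>(x, y). g x * f y"]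
      sum_nonneg[of "F \<inter> F'" "\<lambda>(x, y). g x * f y"] nonneg by auto
  have "cover_graph A = (F1 \<union> F2) \<union> (F1\<inverse> \<union> F2\<inverse>)"
    unfolding cover_graph_def split(1) by auto
  then have "(\<Sum>(x, y)\<in>cover_graph A. g x * f y)
      \<le> ((\<Sum>(x, y)\<in>F1. g x * f y) + (\<Sum>(x, y)\<in>F2. g x * f y))
        + ((\<Sum>(x, y)\<in>F1\<inverse>. g x * f y) + (\<Sum>(x, y)\<in>F2\<inverse>. g x * f y))"
    using un[of "F1 \<union> F2" "F1\<inverse> \<union> F2\<inverse>"] un[of F1 F2] un[of "F1\<inverse>" "F2\<inverse>"] fin by auto
  also have "\<dots> \<le> (s / 2 * ?S + s / 2 * ?S) + (s / 2 * ?S + s / 2 * ?S)"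
    unfolding conv
    using b1[of g f] b2[of g f] b1[of f g] b2[of f g] by (simp add: add.commute)
  finally show ?thesis by simp
qed

text \<open>
  Ordered pairs, including the diagonal: their number is then a sum over the full square of \<open>A\<close>, which
  splits over the fibres of a coordinate projection.
\<close>

definition dist_le_pairs :: "nat \<Rightarrow> 'a set set \<Rightarrow> ('a set \<times> 'a set) set" where
  "dist_le_pairs r A = {(x, y). x \<in> A \<and> y \<in> A \<and> card (x - y) + card (y - x) \<le> r}"

lemma pairs_at_distance_bound:
  fixes A :: "'a set set"
  assumes V: "finite V" "A \<subseteq> Pow V" and down: "down_closed A"
  shows "card {(x, y). x \<in> A \<and> y \<in> A \<and> card (x - y) + card (y - x) = d} * fact d
    \<le> 2 ^ d * (\<Sum>x\<in>A. \<Sum>y\<in>A. walks (cover_graph A) d x y)"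
proof -
  have A: "finite A" using V finite_subset by blast
  let ?P = "{(x, y). x \<in> A \<and> y \<in> A \<and> card (x - y) + card (y - x) = d}"
  have P: "?P \<subseteq> A \<times> A" by auto
  have "fact d \<le> 2 ^ d * walks (cover_graph A) d x y" if "(x, y) \<in> ?P" for x y
  proof -
    let ?a = "card (x - y)" and ?b = "card (y - x)"
    have d: "?a + ?b = d" using that by auto
    have "x \<subseteq> V" "y \<subseteq> V" using that V(2) by auto
    then have "finite x" "finite y" using V(1) by (auto intro: finite_subset)
    then have w: "fact ?a * fact ?b \<le> walks (cover_graph A) d x y"
      using walks_between_close_sets[OF A down, of x y ?a ?b] that unfolding d by blast
    have "d - ?a = ?b" using d by linarith
    then have "fact d = (fact ?a * fact ?b) * (d choose ?a)"
      using binomial_fact_lemma[of ?a d] d by simp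
    also have "\<dots> \<le> walks (cover_graph A) d x y * 2 ^ d"
      by (rule mult_le_mono[OF w binomial_le_pow2])
    finally show ?thesis by (simp only: mult.commute)
  qed
  then have "(\<Sum>(x, y)\<in>?P. fact d) \<le> (\<Sum>(x, y)\<in>?P. 2 ^ d * walks (cover_graph A) d x y)"
    by (intro sum_mono) auto
  also have "\<dots> \<le> (\<Sum>(x, y)\<in>A \<times> A. 2 ^ d * walks (cover_graph A) d x y)"
    using P A by (intro sum_mono2) auto
  also have "\<dots> = 2 ^ d * (\<Sum>x\<in>A. \<Sum>y\<in>A. walks (cover_graph A) d x y)"
    by (simp add: sum.cartesian_product sum_distrib_left case_prod_unfold)
  finally show ?thesis by simp
qed

text \<open>
  Since \<open>c / t\<close> is at least 1, each term is at most \<open>(c / t) ^ N\<close> times the corresponding term of the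
  series of \<open>exp (2 * t)\<close>.
\<close>

lemma truncated_exp_bound:
  fixes c t :: real
  assumes "0 < t" "t \<le> c"
  shows "(\<Sum>d\<le>N. (2 * c) ^ d / fact d) \<le> (c / t) ^ N * exp (2 * t)"
proof -
  have "(2 * c) ^ d / fact d \<le> (c / t) ^ N * ((2 * t) ^ d / fact d)" if "d \<le> N" for d
  proof -
    have "2 * c = (c / t) * (2 * t)" using assms(1) by simp
    then have "(2 * c) ^ d = (c / t) ^ d * (2 * t) ^ d" by (metis power_mult_distrib)
    also have "\<dots> \<le> (c / t) ^ N * (2 * t) ^ d"
      using assms that by (intro mult_right_mono power_increasing) auto
    finally show ?thesis by (simp add: divide_right_mono)
  qed
  then have "(\<Sum>d\<le>N. (2 * c) ^ d / fact d) \<le> (\<Sum>d\<le>N. (c / t) ^ N * ((2 * t) ^ d / fact d))"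
    by (intro sum_mono) auto
  also have "\<dots> = (c / t) ^ N * (\<Sum>d\<le>N. (2 * t) ^ d / fact d)" by (simp add: sum_distrib_left)
  also have "(\<Sum>d\<le>N. (2 * t) ^ d / fact d) \<le> exp (2 * t)"
  proof -
    have "(\<lambda>d. (2 * t) ^ d / fact d) sums exp (2 * t)"
      using exp_converges[of "2 * t"] by (simp add: divide_inverse mult.commute)
    then show ?thesis
      using sum_le_suminf[of "\<lambda>d. (2 * t) ^ d / fact d" "{..N}"] assms(1)
      by (auto simp: sums_iff)
  qed
  finally show ?thesis using assms by (simp add: mult_left_mono)
qed

lemma down_set_close_pairs_bound:
  fixes A :: "'a set set"
  assumes V: "finite V" "A \<subseteq> Pow V" and down: "down_closed A"
    and size: "\<And>x. x \<in> A \<Longrightarrow> card x \<le> L"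
    and split: "covers A = F1 \<union> F2" "\<And>z. card (F1 `` {z}) \<le> p" "\<And>x. card (F2\<inverse> `` {x}) \<le> q"
    and s: "0 < L" "0 < q" "real p * real L \<le> s\<^sup>2" "real (card V) * real q \<le> s\<^sup>2"
    and t: "0 < t" "real t \<le> 4 * s"
  shows "real (card (dist_le_pairs (2 * t) A)) \<le> (4 * exp 1 * s / real t) ^ (2 * t) * real (card A)"
proof -
  have A: "finite A" using V finite_subset by blast
  have "0 < s" using t by linarith
  define P where "P d = {(x, y). x \<in> A \<and> y \<in> A \<and> card (x - y) + card (y - x) = d}" for d
  have "P d \<subseteq> A \<times> A" for d unfolding P_def by auto
  then have finP: "finite (P d)" for d using A finite_subset by blast
  have Pd: "real (card (P d)) \<le> (2 * (4 * s)) ^ d / fact d * real (card A)" for d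
  proof -
    have "real (card (P d) * fact d)
        \<le> real (2 ^ d * (\<Sum>x\<in>A. \<Sum>y\<in>A. walks (cover_graph A) d x y))"
      using pairs_at_distance_bound[OF V down, of d] unfolding P_def by (intro of_nat_mono)
    also have "\<dots> = 2 ^ d * real (\<Sum>x\<in>A. \<Sum>y\<in>A. walks (cover_graph A) d x y)"
      by simp
    also have "\<dots> \<le> 2 ^ d * ((4 * s) ^ d * real (card A))"
      by (intro mult_left_mono walks_total_bound[OF A cover_graph_subset]
          cover_graph_quadratic_form[OF V size split])
        (use s \<open>0 < s\<close> in auto)
    also have "\<dots> = (2 * (4 * s)) ^ d * real (card A)"
      by (simp only: power_mult_distrib mult.assoc)
    finally have "real (card (P d)) * fact d \<le> (2 * (4 * s)) ^ d * real (card A)"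
      by (simp only: of_nat_mult of_nat_fact)
    then show ?thesis by (simp only: times_divide_eq_left pos_le_divide_eq[OF fact_gt_zero])
  qed
  have "dist_le_pairs (2 * t) A = (\<Union>d\<le>2 * t. P d)" unfolding dist_le_pairs_def P_def by auto
  then have "real (card (dist_le_pairs (2 * t) A)) \<le> (\<Sum>d\<le>2 * t. real (card (P d)))"
    using card_UN_le[of "{..2 * t}" P] by (simp flip: of_nat_sum)
  also have "\<dots> \<le> (\<Sum>d\<le>2 * t. (2 * (4 * s)) ^ d / fact d * real (card A))"
    by (intro sum_mono Pd)
  also have "\<dots> = (\<Sum>d\<le>2 * t. (2 * (4 * s)) ^ d / fact d) * real (card A)"
    by (simp add: sum_distrib_right)
  also have "\<dots> \<le> ((4 * s / real t) ^ (2 * t) * exp (2 * real t)) * real (card A)"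
    using t by (intro mult_right_mono truncated_exp_bound) auto
  also have "exp (2 * real t) = exp 1 ^ (2 * t)"
    by (simp flip: exp_of_nat_mult)
  also have "(4 * s / real t) ^ (2 * t) * exp 1 ^ (2 * t) = (4 * exp 1 * s / real t) ^ (2 * t)"
    by (simp add: mult_ac flip: power_mult_distrib)
  finally show ?thesis .
qed

section \<open>Compression to a down-set\<close>

text \<open>
  On each fibre, consisting of \<open>w\<close> and \<open>insert i w\<close> with \<open>i\<close> not in \<open>w\<close>, the members of the family are
  pushed to the lower position.
\<close>

definition compress :: "'a \<Rightarrow> 'a set set \<Rightarrow> 'a set set" where
  "compress i A = {x. if i \<in> x then x \<in> A \<and> x - {i} \<in> A else x \<in> A \<or> insert i x \<in> A}"

lemma mem_compress:
  assumes "i \<notin> w"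
  shows "w \<in> compress i A \<longleftrightarrow> w \<in> A \<or> insert i w \<in> A"
    and "insert i w \<in> compress i A \<longleftrightarrow> w \<in> A \<and> insert i w \<in> A"
  using assms by (auto simp: compress_def)

lemma sum_over_fibres:
  fixes g :: "'a set \<Rightarrow> nat"
  assumes V: "finite V" "i \<in> V" and B: "B \<subseteq> Pow V"
  shows "sum g B = (\<Sum>w\<in>Pow (V - {i}).
    of_bool (w \<in> B) * g w + of_bool (insert i w \<in> B) * g (insert i w))"
proof -
  let ?W = "Pow (V - {i})"
  have PV: "Pow V = ?W \<union> insert i ` ?W"
    using Pow_insert[of i "V - {i}"] V(2) by (simp add: insert_absorb)
  have "sum g B = (\<Sum>x\<in>Pow V. of_bool (x \<in> B) * g x)"
    using V(1) B by (intro sum.mono_neutral_cong_left) auto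
  also have "\<dots> = (\<Sum>x\<in>?W. of_bool (x \<in> B) * g x) + (\<Sum>x\<in>insert i ` ?W. of_bool (x \<in> B) * g x)"
    unfolding PV using V(1) by (intro sum.union_disjoint) auto
  also have "(\<Sum>x\<in>insert i ` ?W. of_bool (x \<in> B) * g x)
      = (\<Sum>w\<in>?W. of_bool (insert i w \<in> B) * g (insert i w))"
    by (subst sum.reindex) (auto simp: inj_on_def)
  finally show ?thesis by (simp add: sum.distrib)
qed

lemma compress_subset:
  assumes "i \<in> V" "A \<subseteq> Pow V"
  shows "compress i A \<subseteq> Pow V"
  using assms unfolding compress_def by (auto split: if_splits)

lemma card_compress:
  assumes V: "finite V" "i \<in> V" and A: "A \<subseteq> Pow V"
  shows "card (compress i A) = card A"
proof -
  have "sum (\<lambda>_. 1) (compress i A) = sum (\<lambda>_. 1 :: nat) A"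
    unfolding sum_over_fibres[OF V A] sum_over_fibres[OF V compress_subset[OF V(2) A]]
  proof (intro sum.cong refl)
    fix w assume "w \<in> Pow (V - {i})"
    then have "i \<notin> w" by blast
    then show "of_bool (w \<in> compress i A) * 1 + of_bool (insert i w \<in> compress i A) * 1
        = (of_bool (w \<in> A) * 1 + of_bool (insert i w \<in> A) * 1 :: nat)"
      using mem_compress[of i w A] by auto
  qed
  then show ?thesis by simp
qed

lemma sum_card_compress_less:
  assumes V: "finite V" and A: "A \<subseteq> Pow V" and x: "x \<in> A" "i \<in> x" "x - {i} \<notin> A"
  shows "sum card (compress i A) < sum card A"
proof -
  have i: "i \<in> V" using A x by blast
  show ?thesis
    unfolding sum_over_fibres[OF V i A] sum_over_fibres[OF V i compress_subset[OF i A]]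
  proof (rule sum_strict_mono_ex1)
    have finw: "finite w" "i \<notin> w" if "w \<in> Pow (V - {i})" for w
      using that V by (auto intro: finite_subset)
    show "\<forall>w\<in>Pow (V - {i}). of_bool (w \<in> compress i A) * card w
        + of_bool (insert i w \<in> compress i A) * card (insert i w)
      \<le> of_bool (w \<in> A) * card w + of_bool (insert i w \<in> A) * card (insert i w)"
      using finw by (auto simp: mem_compress)
    have xw: "insert i (x - {i}) = x" using x(2) by blast
    have w: "x - {i} \<in> Pow (V - {i})" using A x by blast
    have "card x = Suc (card (x - {i}))"
      using finw(1)[OF w] x(2) by (metis card.remove finite_Diff2 finite.emptyI finite_insert)
    then show "\<exists>w\<in>Pow (V - {i}). of_bool (w \<in> compress i A) * card w
        + of_bool (insert i w \<in> compress i A) * card (insert i w)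
      < of_bool (w \<in> A) * card w + of_bool (insert i w \<in> A) * card (insert i w)"
      using x finw[OF w] mem_compress[OF finw(2)[OF w], of A]
      by (intro bexI[OF _ w]) (simp only: xw, simp)
  qed (use V in auto)
qed

text \<open>
  Over \<open>w\<close> and \<open>v\<close>, two sets in equal position are at the distance of \<open>w\<close> and \<open>v\<close>, and two sets in
  different positions at that distance plus 1.
\<close>

lemma card_dist_le_pairs_fibres:
  assumes V: "finite V" "i \<in> V" and B: "B \<subseteq> Pow V"
  shows "card (dist_le_pairs r B) = (\<Sum>w\<in>Pow (V - {i}). \<Sum>v\<in>Pow (V - {i}).
    (of_bool (w \<in> B \<and> v \<in> B) + of_bool (insert i w \<in> B \<and> insert i v \<in> B))
        * of_bool (card (w - v) + card (v - w) \<le> r)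
    + (of_bool (w \<in> B \<and> insert i v \<in> B) + of_bool (insert i w \<in> B \<and> v \<in> B))
        * of_bool (card (w - v) + card (v - w) + 1 \<le> r))"
proof -
  define c where "c x y = (of_bool (card (x - y) + card (y - x) \<le> r) :: nat)" for x y :: "'a set"
  have fB: "finite B" using V B finite_subset by blast
  have "dist_le_pairs r B = {p \<in> B \<times> B. card (fst p - snd p) + card (snd p - fst p) \<le> r}"
    unfolding dist_le_pairs_def by auto
  then have "card (dist_le_pairs r B)
      = (\<Sum>p\<in>{p \<in> B \<times> B. card (fst p - snd p) + card (snd p - fst p) \<le> r}. 1)"
    by simp
  also have "\<dots> = (\<Sum>p\<in>B \<times> B. c (fst p) (snd p))"
    using fB unfolding c_def by (intro sum.mono_neutral_cong_left) auto
  also have "\<dots> = (\<Sum>x\<in>B. \<Sum>y\<in>B. c x y)" by (simp add: sum.cartesian_product case_prod_unfold)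
  also have "\<dots> = (\<Sum>w\<in>Pow (V - {i}). \<Sum>v\<in>Pow (V - {i}).
      (of_bool (w \<in> B \<and> v \<in> B) * c w v + of_bool (w \<in> B \<and> insert i v \<in> B) * c w (insert i v))
      + (of_bool (insert i w \<in> B \<and> v \<in> B) * c (insert i w) v
        + of_bool (insert i w \<in> B \<and> insert i v \<in> B) * c (insert i w) (insert i v)))"
    unfolding sum_over_fibres[OF V B]
    by (simp add: sum.distrib sum_distrib_left distrib_left of_bool_conj mult.assoc)
  also have "\<dots> = (\<Sum>w\<in>Pow (V - {i}). \<Sum>v\<in>Pow (V - {i}).
    (of_bool (w \<in> B \<and> v \<in> B) + of_bool (insert i w \<in> B \<and> insert i v \<in> B))
        * of_bool (card (w - v) + card (v - w) \<le> r)
    + (of_bool (w \<in> B \<and> insert i v \<in> B) + of_bool (insert i w \<in> B \<and> v \<in> B))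
        * of_bool (card (w - v) + card (v - w) + 1 \<le> r))"
  proof (intro sum.cong refl)
    fix w v assume "w \<in> Pow (V - {i})" "v \<in> Pow (V - {i})"
    then have wv: "i \<notin> w" "i \<notin> v" "finite w" "finite v" using V(1) by (auto intro: finite_subset)
    have "insert i w - insert i v = w - v" "insert i v - insert i w = v - w"
      "insert i w - v = insert i (w - v)" "insert i v - w = insert i (v - w)"
      "w - insert i v = w - v" "v - insert i w = v - w"
      using wv by auto
    then have "c (insert i w) (insert i v) = c w v"
      "c (insert i w) v = of_bool (card (w - v) + card (v - w) + 1 \<le> r)"
      "c w (insert i v) = of_bool (card (w - v) + card (v - w) + 1 \<le> r)"
      using wv unfolding c_def by simp_all
    then show "(of_bool (w \<in> B \<and> v \<in> B) * c w v + of_bool (w \<in> B \<and> insert i v \<in> B) * c w (insert i v))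
      + (of_bool (insert i w \<in> B \<and> v \<in> B) * c (insert i w) v
        + of_bool (insert i w \<in> B \<and> insert i v \<in> B) * c (insert i w) (insert i v))
      = (of_bool (w \<in> B \<and> v \<in> B) + of_bool (insert i w \<in> B \<and> insert i v \<in> B))
        * of_bool (card (w - v) + card (v - w) \<le> r)
      + (of_bool (w \<in> B \<and> insert i v \<in> B) + of_bool (insert i w \<in> B \<and> v \<in> B))
        * of_bool (card (w - v) + card (v - w) + 1 \<le> r)"
      by (simp add: distrib_right c_def)
  qed
  finally show ?thesis .
qed

text \<open>
  Consider the fibres over \<open>w\<close> and \<open>v\<close>. If \<open>w\<close> and \<open>v\<close> are at distance less than \<open>r\<close>, all pairs
  count, and their number depends only on the sizes of the two fibres. If the distance is exactly
  \<open>r\<close>, only pairs in equal position count, and pushing both fibres down aligns as many of them as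
  possible. Beyond distance \<open>r\<close> nothing counts.
\<close>

lemma dist_le_pairs_compress:
  assumes V: "finite V" "i \<in> V" and A: "A \<subseteq> Pow V"
  shows "card (dist_le_pairs r A) \<le> card (dist_le_pairs r (compress i A))"
  unfolding card_dist_le_pairs_fibres[OF V A]
    card_dist_le_pairs_fibres[OF V compress_subset[OF V(2) A]]
proof (intro sum_mono)
  fix w v assume "w \<in> Pow (V - {i})" "v \<in> Pow (V - {i})"
  then have i: "i \<notin> w" "i \<notin> v" by auto
  show "(of_bool (w \<in> A \<and> v \<in> A) + of_bool (insert i w \<in> A \<and> insert i v \<in> A))
      * of_bool (card (w - v) + card (v - w) \<le> r)
    + (of_bool (w \<in> A \<and> insert i v \<in> A) + of_bool (insert i w \<in> A \<and> v \<in> A))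
      * of_bool (card (w - v) + card (v - w) + 1 \<le> r)
    \<le> (of_bool (w \<in> compress i A \<and> v \<in> compress i A)
        + of_bool (insert i w \<in> compress i A \<and> insert i v \<in> compress i A))
      * of_bool (card (w - v) + card (v - w) \<le> r)
    + (of_bool (w \<in> compress i A \<and> insert i v \<in> compress i A)
        + of_bool (insert i w \<in> compress i A \<and> v \<in> compress i A))
      * (of_bool (card (w - v) + card (v - w) + 1 \<le> r) :: nat)"
    unfolding mem_compress[OF i(1)] mem_compress[OF i(2)]
    by (cases "w \<in> A"; cases "insert i w \<in> A"; cases "v \<in> A"; cases "insert i v \<in> A") auto
qed

lemma down_closed_if_delete_closed:
  assumes fin: "\<And>x. x \<in> A \<Longrightarrow> finite x"
    and del: "\<And>x i. x \<in> A \<Longrightarrow> i \<in> x \<Longrightarrow> x - {i} \<in> A"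
  shows "down_closed A"
  unfolding down_closed_def
proof (intro ballI allI impI)
  fix x y assume "x \<in> A" "y \<subseteq> x"
  have "x - s \<in> A" if "finite s" "s \<subseteq> x" for s
    using that
  proof (induction s rule: finite_induct)
    case empty
    then show ?case using \<open>x \<in> A\<close> by simp
  next
    case (insert i s)
    then have "(x - s) - {i} \<in> A" by (intro del) auto
    moreover have "x - insert i s = (x - s) - {i}" by blast
    ultimately show ?case by simp
  qed
  then have "x - (x - y) \<in> A" using fin[OF \<open>x \<in> A\<close>] by simp
  then show "y \<in> A" using \<open>y \<subseteq> x\<close> by (simp add: double_diff)
qed

text \<open>
  A compression that changes the family lowers the total size of its members, so the process stops, and
  it can stop only at a down-set.
\<close>

lemma exists_down_closed_family:
  assumes V: "finite V" and A: "A \<subseteq> Pow V"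
  shows "\<exists>B. B \<subseteq> Pow V \<and> down_closed B \<and> card B = card A \<and>
    card (dist_le_pairs r A) \<le> card (dist_le_pairs r B)"
  using A
proof (induction "sum card A" arbitrary: A rule: less_induct)
  case less
  show ?case
  proof (cases "\<forall>x\<in>A. \<forall>i\<in>x. x - {i} \<in> A")
    case True
    moreover have "finite x" if "x \<in> A" for x
      using that less.prems V by (auto intro: finite_subset)
    ultimately have "down_closed A" by (intro down_closed_if_delete_closed) auto
    then show ?thesis using less.prems by blast
  next
    case False
    then obtain x i where x: "x \<in> A" "i \<in> x" "x - {i} \<notin> A" by blast
    then have i: "i \<in> V" using less.prems by blast
    from less.hyps[OF sum_card_compress_less[OF V less.prems x] compress_subset[OF i less.prems]]
    obtain B where B: "B \<subseteq> Pow V" "down_closed B" "card B = card (compress i A)"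
        "card (dist_le_pairs r (compress i A)) \<le> card (dist_le_pairs r B)"
      by blast
    have "card (dist_le_pairs r A) \<le> card (dist_le_pairs r B)"
      using dist_le_pairs_compress[OF V i less.prems] B(4) le_trans by blast
    then show ?thesis using B card_compress[OF V i less.prems] by metis
  qed
qed

section \<open>Vertices of the cube as finite sets\<close>

definition support :: "nat \<Rightarrow> (nat \<Rightarrow> nat) \<Rightarrow> nat set" where
  "support n x = {i. i < n \<and> x i = 1}"

lemma inj_on_support: "inj_on (support n) (cube n)"
proof (rule inj_onI)
  fix x y assume xy: "x \<in> cube n" "y \<in> cube n" "support n x = support n y"
  show "x = y"
  proof (rule PiE_ext)
    show "x \<in> {..<n} \<rightarrow>\<^sub>E {0, 1}" "y \<in> {..<n} \<rightarrow>\<^sub>E {0, 1}" using xy unfolding cube_def by auto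
    fix i assume i: "i \<in> {..<n}"
    then have "x i \<in> {0, 1}" "y i \<in> {0, 1}" using xy(1,2) unfolding cube_def by auto
    moreover have "x i = 1 \<longleftrightarrow> y i = 1"
      using xy(3) i unfolding support_def by auto
    ultimately show "x i = y i" by auto
  qed
qed

lemma hamming_dist_support:
  assumes "x \<in> cube n" "y \<in> cube n"
  shows "hamming_dist n x y = card (support n x - support n y) + card (support n y - support n x)"
proof -
  have "x i \<in> {0, 1}" "y i \<in> {0, 1}" if "i < n" for i
    using assms that unfolding cube_def by auto
  then have "{i. i < n \<and> x i \<noteq> y i} = (support n x - support n y) \<union> (support n y - support n x)"
    unfolding support_def by fastforce
  moreover have "finite (support n z)" for z unfolding support_def by simp
  ultimately show ?thesis unfolding hamming_dist_def
    by (simp add: card_Un_disjoint Int_Diff disjoint_iff)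
qed

lemma e_Q_le_dist_le_pairs:
  assumes A: "A \<subseteq> cube n"
  shows "e_Q n r A \<le> card (dist_le_pairs r (support n ` A))"
proof -
  let ?S = "support n" and ?P = "dist_le_pairs r (support n ` A)"
  have "?P \<subseteq> (?S ` A) \<times> (?S ` A)" unfolding dist_le_pairs_def by auto
  moreover have "?S ` A \<subseteq> Pow {..<n}" unfolding support_def by auto
  ultimately have finP: "finite ?P"
    by (meson finite_Pow_iff finite_SigmaI finite_lessThan finite_subset)
  have "{e \<in> Q_edges n r. e \<subseteq> A}
      \<subseteq> (\<lambda>(X, Y). {inv_into (cube n) ?S X, inv_into (cube n) ?S Y}) ` ?P"
  proof
    fix e assume "e \<in> {e \<in> Q_edges n r. e \<subseteq> A}"
    then obtain x y where e: "e = {x, y}" "x \<in> A" "y \<in> A" "hamming_dist n x y \<le> r"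
      unfolding Q_edges_def by blast
    then have c: "x \<in> cube n" "y \<in> cube n" using A by auto
    have "(?S x, ?S y) \<in> ?P"
      using e hamming_dist_support[OF c] unfolding dist_le_pairs_def by auto
    moreover have "e = {inv_into (cube n) ?S (?S x), inv_into (cube n) ?S (?S y)}"
      using c e(1) by (simp add: inv_into_f_f[OF inj_on_support])
    ultimately show "e \<in> (\<lambda>(X, Y). {inv_into (cube n) ?S X, inv_into (cube n) ?S Y}) ` ?P"
      by force
  qed
  then show ?thesis
    unfolding e_Q_def using finP by (meson card_image_le card_mono finite_imageI le_trans)
qed

section \<open>The parameter \<open>\<ell>\<close> and the final estimate\<close>

lemma card_le_log_of_down_closed:
  assumes A: "finite A" "down_closed A" and x: "x \<in> A" "finite x"
  shows "real (card x) \<le> log 2 (real (card A))"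
proof -
  have "Pow x \<subseteq> A" using A(2) x(1) unfolding down_closed_def by blast
  then have "card (Pow x) \<le> card A" using A(1) card_mono by blast
  then have "2 ^ card x \<le> card A" using x(2) by (simp add: card_Pow)
  then show ?thesis by (rule le_log2_of_power)
qed

text \<open>
  With \<open>l = log 2 m\<close> and \<open>\<rho> = n / l\<close>, the quotient in the definition of \<open>ell\<close> is \<open>2 * l / log 2 \<rho>\<close>.
  If \<open>ell\<close> is at least this quotient, then \<open>\<rho> ^ ell\<close> is at least \<open>2 powr (2 * l)\<close>, the square of
  \<open>m\<close>. In this case \<open>n * ell \<ge> t\<^sup>2\<close> holds because \<open>t \<le> l\<close> and \<open>log 2 \<rho> \<le> 2 * \<rho>\<close>; if
  \<open>ell = \<lfloor>l\<rfloor>\<close>, both factors are at least \<open>t\<close>.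
\<close>

lemma ell_estimates:
  assumes t: "0 < t" "2 ^ t \<le> m" and mn: "m \<le> 2 ^ n"
  shows "0 < ell m n"
    and "(real t)\<^sup>2 \<le> real n * real_of_int (ell m n)"
    and "ell m n = \<lfloor>log 2 (real m)\<rfloor> \<or> (real m)\<^sup>2 \<le> (real n / log 2 (real m)) ^ nat (ell m n)"
proof -
  define l where "l = log 2 (real m)"
  have m0: "0 < m" using t(2) by (metis gr0I le_zero_eq power_not_zero zero_neq_numeral)
  have tl: "real t \<le> l" using le_log2_of_power[OF t(2)] unfolding l_def .
  have l1: "1 \<le> l" using tl t(1) by linarith
  have ln: "l \<le> real n"
  proof -
    have "real m \<le> 2 ^ n" using mn by (metis of_nat_le_iff of_nat_numeral of_nat_power)
    then show ?thesis unfolding l_def using m0 by (simp add: log_le_iff powr_realpow)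
  qed
  have "0 < ell m n \<and> (real t)\<^sup>2 \<le> real n * real_of_int (ell m n) \<and>
    (ell m n = \<lfloor>l\<rfloor> \<or> (real m)\<^sup>2 \<le> (real n / l) ^ nat (ell m n))"
  proof (cases "ell m n = \<lfloor>l\<rfloor>")
    case True
    have "real t \<le> real_of_int (ell m n)" using tl unfolding True
      by (metis le_floor_iff of_int_le_iff of_int_of_nat_eq)
    moreover have "real t \<le> real n" using tl ln by simp
    ultimately have "(real t)\<^sup>2 \<le> real n * real_of_int (ell m n)"
      unfolding power2_eq_square by (intro mult_mono) auto
    then show ?thesis using True l1 by auto
  next
    case False
    define \<rho> where "\<rho> = real n / l"
    have "l \<noteq> real n" using False unfolding ell_def l_def by auto
    then have ln': "l < real n" using ln by simp
    then have \<rho>: "1 < \<rho>" unfolding \<rho>_def using l1 by simp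
    have log\<rho>: "log 2 \<rho> = log 2 (real n) - log 2 l" "0 < log 2 \<rho>"
      using \<rho> l1 ln' unfolding \<rho>_def by (auto simp: log_divide)
    have ell: "ell m n = \<lceil>2 * l / log 2 \<rho>\<rceil>"
      using False \<open>l \<noteq> real n\<close> unfolding ell_def log\<rho>(1) l_def[symmetric]
      by (auto simp: min_def split: if_splits)
    have pos: "0 < ell m n" unfolding ell using log\<rho>(2) l1 by simp
    define q where "q = nat (ell m n)"
    have q: "real q = real_of_int (ell m n)" unfolding q_def using pos by simp
    have "2 * l / log 2 \<rho> \<le> real q" unfolding q ell by simp
    then have qlog: "2 * l \<le> real q * log 2 \<rho>" using log\<rho>(2) by (simp add: field_simps)
    have "2 powr (2 * l) = (2 powr l)\<^sup>2"
      by (simp only: mult_2 powr_add power2_eq_square)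
    also have "2 powr l = real m" unfolding l_def using m0 by simp
    finally have "(real m)\<^sup>2 \<le> 2 powr (real q * log 2 \<rho>)"
      using qlog by (metis powr_mono one_le_numeral)
    also have "\<dots> = (2 powr log 2 \<rho>) powr real q" by (simp only: powr_powr mult.commute)
    also have "\<dots> = \<rho> ^ q" using \<rho> by (simp add: powr_realpow)
    finally have msq: "(real m)\<^sup>2 \<le> \<rho> ^ q" .
    have "log 2 \<rho> \<le> 2 * \<rho>"
    proof -
      have "ln \<rho> \<le> \<rho>" using \<rho> ln_le_minus_one[of \<rho>] by simp
      moreover have "1 / 2 \<le> ln (2 :: real)" using ln_le_minus_one[of "1 / 2"] by (simp add: ln_div)
      then have "\<rho> \<le> 2 * \<rho> * ln 2" using \<rho> by (simp add: field_simps)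
      ultimately show ?thesis unfolding log_def by (simp add: divide_le_eq)
    qed
    then have "2 * l \<le> real q * (2 * \<rho>)" using qlog
      by (meson mult_left_mono of_nat_0_le_iff order_trans)
    then have "l * l \<le> (real q * \<rho>) * l" using l1 by (intro mult_right_mono) auto
    also have "\<dots> = real n * real q" unfolding \<rho>_def using l1 by simp
    finally have "(real t)\<^sup>2 \<le> real n * real q"
      using mult_mono[OF tl tl] l1 by (simp add: power2_eq_square)
    then show ?thesis using pos msq q unfolding \<rho>_def q_def by simp
  qed
  then show "0 < ell m n" "(real t)\<^sup>2 \<le> real n * real_of_int (ell m n)"
    "ell m n = \<lfloor>log 2 (real m)\<rfloor> \<or> (real m)\<^sup>2 \<le> (real n / log 2 (real m)) ^ nat (ell m n)"
    unfolding l_def by auto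
qed

text \<open>
  The threshold \<open>p = \<lfloor>n * q / l\<rfloor>\<close> is the largest one with \<open>p * l \<le> n * q\<close>. It excludes a stuck
  peeling because \<open>(p + 1) ^ q\<close> exceeds \<open>(n / l) ^ q * q ^ q\<close>, hence \<open>card A * q!\<close>. If \<open>q = L\<close>,
  no peeling is needed: all downward degrees are at most \<open>L\<close>, so every edge may go to \<open>F2\<close>.
\<close>

lemma balanced_covers_split:
  fixes A :: "'a set set"
  assumes A: "finite A" "\<And>x. x \<in> A \<Longrightarrow> finite x" "down_closed A"
    and m: "2 \<le> card A" and size: "\<And>x. x \<in> A \<Longrightarrow> card x \<le> L"
    and l: "real L \<le> l" "0 < l" and q: "0 < q"
    and cases: "q = L \<or> (real (card A))\<^sup>2 \<le> (real n / l) ^ q"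
  shows "\<exists>p F1 F2. covers A = F1 \<union> F2 \<and> (\<forall>z. card (F1 `` {z}) \<le> p) \<and>
    (\<forall>x. card (F2\<inverse> `` {x}) \<le> q) \<and> real p * real L \<le> real n * real q"
  using cases
proof
  assume qL: "q = L"
  have "card ((covers A)\<inverse> `` {x}) \<le> q" for x
  proof (cases "x \<in> A")
    case True
    then show ?thesis using card_lower_covers_le[OF A(2)[OF True]] size[OF True] qL le_trans by blast
  next
    case False
    then have "(covers A)\<inverse> `` {x} = {}" unfolding covers_def by auto
    then show ?thesis by simp
  qed
  then show ?thesis by (intro exI[of _ 0] exI[of _ "{}"] exI[of _ "covers A"]) auto
next
  assume big: "(real (card A))\<^sup>2 \<le> (real n / l) ^ q"
  define \<rho> where "\<rho> = real n / l"
  define p where "p = nat \<lfloor>\<rho> * real q\<rfloor>"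
  have \<rho>: "0 \<le> \<rho>" unfolding \<rho>_def using l by simp
  have p: "real p \<le> \<rho> * real q" "\<rho> * real q < real (p + 1)"
    unfolding p_def using \<rho> by (auto simp: of_nat_floor) linarith
  have "real (card A) \<le> (real (card A))\<^sup>2" using m by (intro self_le_power) auto
  then have "real (card A) \<le> \<rho> ^ q" using big unfolding \<rho>_def by (rule order_trans)
  moreover have "fact q \<le> real q ^ q"
    by (metis fact_le_power of_nat_fact of_nat_le_iff of_nat_power order_refl)
  ultimately have "real (card A) * fact q \<le> \<rho> ^ q * real q ^ q"
    by (intro mult_mono) auto
  also have "\<dots> = (\<rho> * real q) ^ q" by (simp add: power_mult_distrib)
  also have "\<dots> < real (p + 1) ^ q"
    using p(2) q \<rho> by (intro power_strict_mono) auto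
  finally have "real (card A * fact q) < real ((p + 1) ^ q)" by simp
  then have "card A * fact q < (p + 1) ^ q" by (simp only: of_nat_less_iff)
  from covers_split[OF A this] obtain F1 F2 where
    F: "covers A = F1 \<union> F2" "\<forall>z. card (F1 `` {z}) \<le> p" "\<forall>x. card (F2\<inverse> `` {x}) \<le> q" by blast
  have "real p * real L \<le> (\<rho> * real q) * l" using p(1) l \<rho> by (intro mult_mono) auto
  also have "\<dots> = real n * real q" unfolding \<rho>_def using l by simp
  finally show ?thesis using F by blast
qed

lemma down_set_close_pairs_ell_bound:
  assumes V: "finite V" "card V = n" "A \<subseteq> Pow V" and down: "down_closed A"
    and m: "card A = m" and t: "0 < t" "2 ^ t \<le> m" and mn: "m \<le> 2 ^ n"
  shows "real (card (dist_le_pairs (2 * t) A))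
    \<le> (4 * exp 1 / real t) ^ (2 * t) * (real n * real_of_int (ell m n)) ^ t * real m"
proof -
  have A: "finite A" using V finite_subset by blast
  have finA: "finite x" if "x \<in> A" for x using that V by (auto intro: finite_subset)
  define l where "l = log 2 (real m)"
  define L where "L = nat \<lfloor>l\<rfloor>"
  define q where "q = nat (ell m n)"
  note ell = ell_estimates[OF t mn, folded l_def]
  have q: "0 < q" "real q = real_of_int (ell m n)" unfolding q_def using ell(1) by auto
  have tl: "real t \<le> l" using le_log2_of_power[OF t(2)] unfolding l_def .
  have tL: "t \<le> L" unfolding L_def using tl by (simp add: le_nat_floor)
  have l: "real L \<le> l" "0 < l" unfolding L_def using tl t(1) by auto
  have size: "card x \<le> L" if "x \<in> A" for x
    using card_le_log_of_down_closed[OF A down that finA[OF that]]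
    unfolding m L_def l_def by (simp add: le_nat_floor)
  have m2: "2 \<le> card A" unfolding m using t self_le_power[of "2::nat" t] by simp
  have "q = L \<or> (real (card A))\<^sup>2 \<le> (real n / l) ^ q"
    using ell(3) unfolding m q_def L_def by auto
  from balanced_covers_split[OF A finA down m2 size l q(1) this]
  obtain p F1 F2 where F: "covers A = F1 \<union> F2" "\<And>z. card (F1 `` {z}) \<le> p"
      "\<And>x. card (F2\<inverse> `` {x}) \<le> q" "real p * real L \<le> real n * real q"
    by blast
  define s where "s = sqrt (real n * real q)"
  have s2: "s\<^sup>2 = real n * real q" and s0: "0 \<le> s" unfolding s_def by auto
  have "real t \<le> s" unfolding s_def using ell(2) q(2) by (intro real_le_rsqrt) simp
  then have "real (card (dist_le_pairs (2 * t) A)) \<le> (4 * exp 1 * s / real t) ^ (2 * t) * real (card A)"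
    using tL t F(4) q(1) s0 s2 V(2)
    by (intro down_set_close_pairs_bound[OF V(1,3) down size F(1-3)]) auto
  also have "(4 * exp 1 * s / real t) ^ (2 * t) = (4 * exp 1 / real t) ^ (2 * t) * (s\<^sup>2) ^ t"
    by (simp add: power_mult power_mult_distrib power_divide)
  also have "s\<^sup>2 = real n * real_of_int (ell m n)" unfolding s2 q(2) ..
  finally show ?thesis unfolding m .
qed

theorem theorem2:
  fixes m n t :: nat
  assumes "m > 0" and "n > 0" and "t > 0"
    and "2 ^ t \<le> m" and "m \<le> 2 ^ n"
  shows "real (D m n (2 * t))
           \<le> (8 * exp 1 / real t) ^ (2 * t) * (real n * real_of_int (ell m n)) ^ t * real m"
proof -
  let ?b = "\<lambda>c. (c * exp 1 / real t) ^ (2 * t) * (real n * real_of_int (ell m n)) ^ t * real m"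
  let ?E = "{e_Q n (2 * t) A | A. A \<subseteq> cube n \<and> card A = m}"
  have "finite (cube n)" unfolding cube_def by (simp add: finite_PiE)
  moreover have "card (cube n) = 2 ^ n" unfolding cube_def by (simp add: card_PiE numeral_2_eq_2)
  ultimately have "finite ?E" "?E \<noteq> {}"
    using assms(5) obtain_subset_with_card_n[of m "cube n"] by auto
  then have "D m n (2 * t) \<in> ?E" unfolding D_def by (rule Max_in)
  then obtain A where A: "A \<subseteq> cube n" "card A = m" "D m n (2 * t) = e_Q n (2 * t) A" by blast
  let ?S = "support n ` A"
  have S: "?S \<subseteq> Pow {..<n}" unfolding support_def by auto
  have cS: "card ?S = m"
    using A(1,2) by (simp add: card_image inj_on_subset[OF inj_on_support])
  obtain B where B: "B \<subseteq> Pow {..<n}" "down_closed B" "card B = m"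
      "card (dist_le_pairs (2 * t) ?S) \<le> card (dist_le_pairs (2 * t) B)"
    using exists_down_closed_family[OF _ S] cS by auto
  have "real (D m n (2 * t)) \<le> real (card (dist_le_pairs (2 * t) B))"
    using e_Q_le_dist_le_pairs[OF A(1), of "2 * t"] A(3) B(4) by simp
  also have "\<dots> \<le> ?b 4"
    using assms B by (intro down_set_close_pairs_ell_bound[of "{..<n}"]) auto
  also have "\<dots> \<le> ?b 8"
  proof -
    have "0 \<le> (real n * real_of_int (ell m n)) ^ t"
      using ell_estimates(1)[OF assms(3-5)] by simp
    then show ?thesis
      by (intro mult_right_mono power_mono divide_right_mono) auto
  qed
  finally show ?thesis .
qed

end
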